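(* For every $n\ge1$, the cube $Q_n$ and all of its skeletons are Laplacian integral. Specifically, for all $n\geq 1$, $$E^{\rm tot}(Q_n;r,t)=(1+r^2+tr^2)^n=\sum_{k=0}^n t^k\binom{n}{k}r^{2k}(1+r^2)^{n-k},$$ $$E^{\rm ud}(Q_n;r,t)\overset{\circ}{=}\sum_{k=0}^{n-1}t^k\left[\sum_{j=k+1}^n\binom{n}{j}\binom{j-1}{k}r^{2j}\right],$$ where $\overset{\circ}{=}$ means equality up to terms not involving $r$ (i.e. up to the multiplicity of $0$ as an eigenvalue).
   Context: The $n$-cube $Q_n$ is the poset of $n$-tuples $f=(f_1,\dots,f_n)$ with $f_i\in\{0,1,\circledast\}$, ordered by $f\le g$ iff $f_i\le g_i$ for all $i$, where $0<\circledast$, $1<\circledast$, and $0,1$ are incomparable. These are the nonempty faces of the unit cube in $\mathbb{R}^n$. The direction of $f$ is $\mathrm{dir}(f)=\{i : f_i=\circledast\}$ and $\dim f=|\mathrm{dir}(f)|$. A proper cubical complex is a nonempty order ideal $X$ of $Q_n$ (e.g. $Q_n$ itself or its $k$-skeleton, the set of faces of dimension $\le k$); $X_i$ is its set of $i$-dimensional faces (there is no $(-1)$-dimensional face). For $f\le g$ with $\dim f=i-1$, $\dim g=i$, write $\mathrm{dir}(g)=\{a_1<\dots<a_i\}$ and $\mathrm{dir}(f)=\mathrm{dir}(g)\setminus\{a_j\}$; put $\varepsilon(f,g)=(-1)^j$ if $f_{a_j}=0$ and $\varepsilon(f,g)=(-1)^{j+1}$ if $f_{a_j}=1$. If $f\not\le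 g$, put $\varepsilon(f,g)=0$. The boundary map $\partial_{X,i}\colon C_i(X)\to C_{i-1}(X)$ ($C_i(X)$ the free module on $X_i$) is $[g]\mapsto\sum_{f\in X_{i-1}}\varepsilon(f,g)[f]$, with $\partial_{X,0}=0$, and $\partial^*_{X,i}$ is its transpose. The Laplacians on $C_i(X)$ are $$L^{\rm ud}_{X,i}=\partial_{X,i+1}\partial^*_{X,i+1},\quad L^{\rm du}_{X,i}=\partial^*_{X,i}\partial_{X,i},\quad L^{\rm tot}_{X,i}=L^{\rm ud}_{X,i}+L^{\rm du}_{X,i}.$$ For $\bullet\in\{\mathrm{ud},\mathrm{du},\mathrm{tot}\}$, $s^\bullet_i(X)$ is the multiset of eigenvalues of $L^\bullet_{X,i}$ and $E^\bullet(X;r,t)=\sum_{i=0}^{\dim X}\sum_{\lambda\in s^\bullet_i(X)}t^ir^\lambda$. A complex is Laplacian integral if all eigenvalues of all its Laplacians are integers. *)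

theory Defs
  imports
    "HOL-Library.Poly_Mapping"
    "HOL-Library.Product_Plus"
    "HOL-Computational_Algebra.Computational_Algebra"
    "Jordan_Normal_Form.Char_Poly"
begin

text \<open>A face is a list of length \<open>n\<close> over the symbols 0, 1 and the circled asterisk (\<open>CStar\<close>).
  Positions are counted from 0, as usual for lists; only their relative order matters below.\<close>

datatype coord = C0 | C1 | CStar

type_synonym face = "coord list"

definition coord_le :: "coord \<Rightarrow> coord \<Rightarrow> bool" where
  "coord_le a b \<longleftrightarrow> a = b \<or> b = CStar"

definition face_le :: "face \<Rightarrow> face \<Rightarrow> bool" where
  "face_le f g \<longleftrightarrow> list_all2 coord_le f g"

definition dir :: "face \<Rightarrow> nat set" where
  "dir f = {i. i < length f \<and> f ! i = CStar}"

definition face_dim :: "face \<Rightarrow> nat" where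
  "face_dim f = card (dir f)"

definition cube :: "nat \<Rightarrow> face set" where
  "cube n = {f. length f = n}"

definition cubical_complex :: "nat \<Rightarrow> face set \<Rightarrow> bool" where
  "cubical_complex n X \<longleftrightarrow>
     X \<noteq> {} \<and> X \<subseteq> cube n \<and> (\<forall>g\<in>X. \<forall>f\<in>cube n. face_le f g \<longrightarrow> f \<in> X)"

definition skeleton :: "nat \<Rightarrow> nat \<Rightarrow> face set" where
  "skeleton k n = {f \<in> cube n. face_dim f \<le> k}"

definition complex_dim :: "face set \<Rightarrow> nat" where
  "complex_dim X = Max (face_dim ` X)"

text \<open>The ordered basis of \<open>C\<^sub>i(X)\<close>: the \<open>i\<close>-dimensional faces of \<open>X\<close>, in the order of
  \<open>List.n_lists\<close>. Another order would conjugate the Laplacians by a permutation matrix.\<close>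

definition face_list :: "nat \<Rightarrow> face set \<Rightarrow> nat \<Rightarrow> face list" where
  "face_list n X i = filter (\<lambda>f. f \<in> X \<and> face_dim f = i) (List.n_lists n [C0, C1, CStar])"

text \<open>In \<open>incidence f g\<close>, \<open>a\<close> is the direction of \<open>g\<close> missing in \<open>f\<close>, and \<open>j\<close> is its rank in
  \<open>dir g\<close>, counted from 1. The function is meant for faces whose dimensions differ by one.\<close>

definition incidence :: "face \<Rightarrow> face \<Rightarrow> int" where
  "incidence f g =
     (if face_le f g \<and> face_dim g = face_dim f + 1 then
        (let a = the_elem (dir g - dir f); j = card {b \<in> dir g. b \<le> a}
         in if f ! a = C0 then (- 1) ^ j else (- 1) ^ (j + 1))
      else 0)"

text \<open>\<open>boundary n X i\<close> is the matrix of the map from \<open>C\<^sub>i(X)\<close> to \<open>C\<^sub>i\<^sub>-\<^sub>1(X)\<close>. There is no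
  \<open>(-1)\<close>-dimensional face, so for \<open>i = 0\<close> it has no rows.\<close>

fun boundary :: "nat \<Rightarrow> face set \<Rightarrow> nat \<Rightarrow> int mat" where
  "boundary n X 0 = 0\<^sub>m 0 (length (face_list n X 0))"
| "boundary n X (Suc i) =
     mat (length (face_list n X i)) (length (face_list n X (Suc i)))
       (\<lambda>(p, q). incidence (face_list n X i ! p) (face_list n X (Suc i) ! q))"

datatype laplacian_kind = UD | DU | Tot

definition lap_ud :: "nat \<Rightarrow> face set \<Rightarrow> nat \<Rightarrow> int mat" where
  "lap_ud n X i = boundary n X (i + 1) * transpose_mat (boundary n X (i + 1))"

definition lap_du :: "nat \<Rightarrow> face set \<Rightarrow> nat \<Rightarrow> int mat" where
  "lap_du n X i = transpose_mat (boundary n X i) * boundary n X i"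

fun laplacian :: "laplacian_kind \<Rightarrow> nat \<Rightarrow> face set \<Rightarrow> nat \<Rightarrow> int mat" where
  "laplacian UD n X i = lap_ud n X i"
| "laplacian DU n X i = lap_du n X i"
| "laplacian Tot n X i = lap_ud n X i + lap_du n X i"

text \<open>Eigenvalues are taken in the complex numbers, with algebraic multiplicity.\<close>

definition eigenvalue_mset :: "int mat \<Rightarrow> complex multiset" where
  "eigenvalue_mset A = proots (char_poly (map_mat complex_of_int A))"

definition spec :: "laplacian_kind \<Rightarrow> nat \<Rightarrow> face set \<Rightarrow> nat \<Rightarrow> complex multiset" where
  "spec b n X i = eigenvalue_mset (laplacian b n X i)"

definition laplacian_integral :: "nat \<Rightarrow> face set \<Rightarrow> bool" where
  "laplacian_integral n X \<longleftrightarrow> (\<forall>b i. \<forall>\<mu> \<in># spec b n X i. \<mu> \<in> \<int>)"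

text \<open>Formal integer combinations of monomials \<open>t\<^sup>i r\<^sup>\<mu>\<close>. The exponent \<open>\<mu>\<close> is an eigenvalue, which
  need not be a natural number a priori. Multiplication is convolution, so exponents add.\<close>

type_synonym genfun = "(nat \<times> complex) \<Rightarrow>\<^sub>0 int"

definition monomial_tr :: "nat \<Rightarrow> complex \<Rightarrow> genfun" where
  "monomial_tr i \<mu> = Poly_Mapping.single (i, \<mu>) 1"

definition t_var :: genfun where
  "t_var = monomial_tr 1 0"

definition r_var :: genfun where
  "r_var = monomial_tr 0 1"

definition spec_poly :: "laplacian_kind \<Rightarrow> nat \<Rightarrow> face set \<Rightarrow> genfun" where
  "spec_poly b n X = (\<Sum>i = 0..complex_dim X. \<Sum>\<mu> \<in># spec b n X i. monomial_tr i \<mu>)"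

text \<open>Equality up to terms not involving \<open>r\<close>.\<close>

definition eq_mod_r0 :: "genfun \<Rightarrow> genfun \<Rightarrow> bool" where
  "eq_mod_r0 p q \<longleftrightarrow>
     (\<forall>i \<mu>. \<mu> \<noteq> 0 \<longrightarrow> Poly_Mapping.lookup p (i, \<mu>) = Poly_Mapping.lookup q (i, \<mu>))"

lemma set_face_list: "set (face_list n X i) = {f \<in> X \<inter> cube n. face_dim f = i}"
proof -
  have "x \<in> {C0, C1, CStar}" for x
    by (cases x) auto
  then show ?thesis
    by (auto simp: face_list_def cube_def set_n_lists)
qed

lemma distinct_face_list: "distinct (face_list n X i)"
  by (simp add: face_list_def distinct_n_lists)

lemma monomial_tr_eq: "monomial_tr i (of_nat k) = t_var ^ i * r_var ^ k"
proof -
  have "t_var ^ i = monomial_tr i 0" for i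
    by (induction i) (auto simp: t_var_def monomial_tr_def mult_single zero_prod_def
        simp flip: single_one)
  moreover have "r_var ^ k = monomial_tr 0 (of_nat k)" for k
    by (induction k) (auto simp: r_var_def monomial_tr_def mult_single zero_prod_def
        simp flip: single_one)
  ultimately show ?thesis
    by (simp add: monomial_tr_def mult_single)
qed

lemma cubical_complex_skeleton: "cubical_complex n (skeleton k n)"
proof -
  have "dir f \<subseteq> dir g" if "face_le f g" for f g
    using that by (auto simp: face_le_def dir_def list_all2_conv_all_nth coord_le_def)
  moreover have "finite (dir g)" for g
    by (simp add: dir_def)
  ultimately have "face_dim f \<le> face_dim g" if "face_le f g" for f g
    using that by (simp add: face_dim_def card_mono)
  moreover have "dir (replicate n C0) = {}"
    by (auto simp: dir_def)
  then have "replicate n C0 \<in> skeleton k n"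
    by (simp add: skeleton_def cube_def face_dim_def)
  ultimately show ?thesis
    unfolding cubical_complex_def skeleton_def by (auto intro: order_trans)
qed

lemma cubical_complex_cube: "cubical_complex n (cube n)"
  by (auto simp: cubical_complex_def cube_def intro: exI[of _ "replicate n C0"])

end

theory Submission
  imports Defs
begin

text \<open>The chains of the cube form the \<open>n\<close>-th tensor power of the chains of the 1-cube, with the
  boundary map given by the Koszul sign rule (\<open>incidence_Cons\<close>). The signs make the total Laplacian a
  sum of copies of the Laplacian of the 1-cube, one for each coordinate (\<open>hodge_Cons\<close>). The 1-cube has
  eigenvalues 0 and 2 on vertices and 2 on the edge. Tensor products of its eigenvectors are an orthogonal
  eigenbasis for the cube, labelled by its faces, with eigenvalue twice the number of coordinates other than
  \<open>C0\<close> (\<open>spec_Tot_cube\<close>). Summing over the labels coordinate by coordinate gives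
  \<open>(1 + r\<^sup>2 + t r\<^sup>2)\<^sup>n\<close>.

  The up-down spectrum follows from multiplicities alone. Since \<open>\<partial>\<^sup>2 = 0\<close>, the two partial Laplacians
  have product 0, so for a nonzero eigenvalue the multiplicity in the total Laplacian is the sum of those
  in the partial ones (\<open>char_poly_add_mult_0\<close>). Since \<open>A B\<close> and \<open>B A\<close> have the same nonzero eigenvalues
  (\<open>char_poly_mult_commute\<close>), the down-up Laplacian in dimension \<open>k + 1\<close> agrees with the up-down
  Laplacian in dimension \<open>k\<close> there. The eigenvalue \<open>2 j\<close> occurs \<open>(n choose j) * (j choose k)\<close> times in the
  total Laplacian in dimension \<open>k\<close>, and the resulting recurrence in \<open>k\<close> has the solution
  \<open>(n choose j) * ((j - 1) choose k)\<close> (\<open>count_spec_UD_cube_even\<close>).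

  All nonzero eigenvalues of the partial Laplacians are thus eigenvalues of the total one, hence even
  integers. The Laplacians of the \<open>k\<close>-skeleton agree with those of the cube below dimension \<open>k\<close>; in
  dimension \<open>k\<close> the up-down part becomes zero, and the down-up part is unchanged.\<close>

section \<open>The incidence numbers of the cube\<close>

lemma cube_Suc: "cube (Suc n) = (\<lambda>(a, f). a # f) ` (UNIV \<times> cube n)"
  by (force simp: cube_def length_Suc_conv)

lemma UNIV_coord: "(UNIV :: coord set) = {C0, C1, CStar}"
  using coord.exhaust by auto

lemma finite_cube [simp]: "finite (cube n)"
  by (induction n) (auto simp: cube_Suc UNIV_coord, simp add: cube_def)

lemma sum_cube_Suc:
  fixes F :: "face \<Rightarrow> 'a :: comm_monoid_add"
  shows "(\<Sum>f\<in>cube (Suc n). F f) =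
    (\<Sum>f\<in>cube n. F (C0 # f)) + (\<Sum>f\<in>cube n. F (C1 # f)) + (\<Sum>f\<in>cube n. F (CStar # f))"
proof -
  have "(\<Sum>f\<in>cube (Suc n). F f) = (\<Sum>(a, f)\<in>UNIV \<times> cube n. F (a # f))"
    unfolding cube_Suc by (subst sum.reindex) (auto simp: inj_on_def intro!: sum.cong)
  also have "\<dots> = (\<Sum>a\<in>UNIV. \<Sum>f\<in>cube n. F (a # f))"
    by (subst sum.cartesian_product) simp
  finally show ?thesis
    by (simp add: UNIV_coord add.assoc)
qed

lemma dir_Cons: "dir (a # f) = (if a = CStar then {0} else {}) \<union> Suc ` dir f"
proof -
  have "i \<in> dir (a # f) \<longleftrightarrow> i \<in> (if a = CStar then {0} else {}) \<union> Suc ` dir f" for i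
    by (cases i) (auto simp: dir_def)
  then show ?thesis
    by blast
qed

lemma finite_dir [simp]: "finite (dir f)"
  by (simp add: dir_def)

lemma face_dim_Nil [simp]: "face_dim [] = 0"
  by (simp add: face_dim_def dir_def)

lemma face_dim_Cons [simp]: "face_dim (a # f) = (if a = CStar then 1 else 0) + face_dim f"
  by (auto simp: face_dim_def dir_Cons card_image)

lemma face_dim_le_length: "face_dim f \<le> length f"
  by (induction f) auto

lemma face_le_Cons: "face_le (a # f) (b # g) \<longleftrightarrow> coord_le a b \<and> face_le f g"
  by (simp add: face_le_def)

lemma dir_mono: "face_le f g \<Longrightarrow> dir f \<subseteq> dir g"
  by (auto simp: face_le_def dir_def list_all2_conv_all_nth coord_le_def)

lemma face_le_dim: "face_le f g \<Longrightarrow> face_dim f \<le> face_dim g"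
  by (simp add: face_dim_def card_mono dir_mono)

lemma face_le_same_dim:
  assumes "length f = length g"
  shows "face_le f g \<and> face_dim g = face_dim f \<longleftrightarrow> f = g"
  using assms
proof (induction f g rule: list_induct2)
  case Nil
  show ?case by (simp add: face_le_def)
next
  case (Cons a f b g)
  then show ?case
    using face_le_dim[of f g] by (cases a; cases b) (auto simp: face_le_Cons coord_le_def)
qed


lemma incidence_facet:
  assumes "face_le f g" "dir g - dir f = {x}"
  shows "incidence f g = (if f ! x = C0 then 1 else -1) * (- 1) ^ card {b \<in> dir g. b \<le> x}"
proof -
  have "face_dim g - face_dim f = 1"
    using card_Diff_subset[OF finite_dir dir_mono[OF assms(1)]] assms(2) by (simp add: face_dim_def)
  then show ?thesis
    using assms by (simp add: incidence_def)
qed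

lemma incidence_eq_0: "\<not> (face_le f g \<and> face_dim g = face_dim f + 1) \<Longrightarrow> incidence f g = 0"
  by (auto simp: incidence_def)

lemma facet_direction:
  assumes "face_le f g" "face_dim g = face_dim f + 1"
  obtains x where "dir g - dir f = {x}"
proof -
  have "card (dir g - dir f) = 1"
    using card_Diff_subset[OF finite_dir dir_mono[OF assms(1)]] assms(2) by (simp add: face_dim_def)
  then show ?thesis
    by (rule card_1_singletonE) (rule that)
qed

text \<open>The incidence number of an end point and the edge in the 1-cube.\<close>

definition facet_sign :: "coord \<Rightarrow> coord \<Rightarrow> int" where
  "facet_sign a b = (if b = CStar then (case a of C0 \<Rightarrow> -1 | C1 \<Rightarrow> 1 | CStar \<Rightarrow> 0) else 0)"

lemma incidence_Nil [simp]: "incidence [] [] = 0"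
  by (simp add: incidence_def)

text \<open>The Koszul sign rule. If the missing direction is the first coordinate, then the two tails agree and
  the sign is that of the 1-cube. Otherwise the heads agree, and a leading asterisk raises the rank of
  the missing direction by one, which costs a factor of \<open>-1\<close>. So the incidence matrix of
  \<open>Q\<^sub>n\<^sub>+\<^sub>1\<close> is \<open>d \<otimes> 1 + s \<otimes> \<partial>\<close>, where \<open>d\<close> is the incidence matrix of the 1-cube and
  \<open>s = diag(1, 1, -1)\<close>.\<close>

lemma incidence_Cons:
  assumes len: "length f = length g"
  shows "incidence (a # f) (b # g) =
    (if f = g then facet_sign a b else 0) +
    (if a = b then (if a = CStar then -1 else 1) * incidence f g else 0)"
proof (cases "a = b")
  case True
  show ?thesis
  proof (cases "face_le f g \<and> face_dim g = face_dim f + 1")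
    case facet: True
    then obtain x where x: "dir g - dir f = {x}"
      using facet_direction by blast
    have "dir (a # g) - dir (a # f) = {Suc x}"
    proof -
      have "dir (a # g) - dir (a # f) = Suc ` (dir g - dir f)"
        by (auto simp: dir_Cons)
      then show ?thesis by (simp add: x)
    qed
    moreover have "{c \<in> dir (a # g). c \<le> Suc x} =
        (if a = CStar then {0} else {}) \<union> Suc ` {c \<in> dir g. c \<le> x}"
      by (auto simp: dir_Cons)
    then have "card {c \<in> dir (a # g). c \<le> Suc x} =
        (if a = CStar then 1 else 0) + card {c \<in> dir g. c \<le> x}"
      by (auto simp: card_image)
    moreover have "face_le (a # f) (a # g)"
      using facet by (simp add: face_le_Cons coord_le_def)
    moreover have "facet_sign a a = 0"
      by (cases a) (auto simp: facet_sign_def)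
    ultimately show ?thesis
      using incidence_facet[of f g x] incidence_facet[of "a # f" "a # g" "Suc x"] facet x
      by (simp add: True)
  next
    case False
    moreover have "facet_sign a a = 0"
      by (cases a) (auto simp: facet_sign_def)
    ultimately show ?thesis
      using True incidence_eq_0[of f g] incidence_eq_0[of "a # f" "a # g"]
      by (auto simp: face_le_Cons)
  qed
next
  case False
  show ?thesis
  proof (cases "b = CStar \<and> f = g")
    case True
    have "dir (CStar # g) - dir (a # g) = {0}" "{c \<in> dir (CStar # g). c \<le> 0} = {0}"
      using False True by (auto simp: dir_Cons)
    moreover have "face_le (a # g) (CStar # g)"
      by (simp add: face_le_def coord_le_def list_all2_refl)
    ultimately show ?thesis
      using True False incidence_facet[of "a # g" "CStar # g" 0]
      by (cases a) (auto simp: facet_sign_def)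
  next
    case other: False
    then have "incidence (a # f) (b # g) = 0"
      using False face_le_same_dim[OF len]
      by (intro incidence_eq_0) (auto simp: face_le_Cons coord_le_def)
    then show ?thesis
      using False other by (auto simp: facet_sign_def)
  qed
qed

lemma cube_0: "cube 0 = {[]}"
  by (auto simp: cube_def)

text \<open>The square of \<open>d \<otimes> 1 + s \<otimes> \<partial>\<close> is \<open>d\<^sup>2 \<otimes> 1 + (d s + s d) \<otimes> \<partial> + s\<^sup>2 \<otimes> \<partial>\<^sup>2\<close>. Here
  \<open>d\<^sup>2 = 0\<close>, the sign \<open>s\<close> anticommutes with \<open>d\<close>, and \<open>\<partial>\<^sup>2 = 0\<close> by induction.\<close>

lemma boundary_boundary:
  assumes "f \<in> cube n" "h \<in> cube n"
  shows "(\<Sum>g\<in>cube n. incidence f g * incidence g h) = 0"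
  using assms
proof (induction n arbitrary: f h)
  case 0
  then show ?case by (simp add: cube_0)
next
  case (Suc n)
  obtain a f' where f: "f = a # f'" "f' \<in> cube n"
    using Suc.prems by (auto simp: cube_Suc)
  obtain c h' where h: "h = c # h'" "h' \<in> cube n"
    using Suc.prems by (auto simp: cube_Suc)
  have *: "incidence (a # f') (b # g) * incidence (b # g) (c # h') =
     (if g = f' then facet_sign a b * (if f' = h' then facet_sign b c else 0) +
        facet_sign a b * (if b = c then (if b = CStar then -1 else 1) * incidence f' h' else 0) else 0)
     + (if g = h' then facet_sign b c * (if a = b then (if a = CStar then -1 else 1) * incidence f' h' else 0) else 0)
     + (if a = b \<and> b = c then incidence f' g * incidence g h' else 0)" if "g \<in> cube n" for b g
    using f h that by (auto simp: incidence_Cons cube_def algebra_simps)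
  show ?case
    using Suc.IH[OF f(2) h(2)] f h
    by (simp add: sum_cube_Suc * sum.distrib split del: if_split;
        cases a; cases c; simp add: facet_sign_def)
qed

section \<open>The total Laplacian and its eigenvectors\<close>

text \<open>The total Laplacian on all chains at once, as a matrix indexed by the faces of every dimension. It
  is block diagonal, with the total Laplacians of the single dimensions as blocks.\<close>

definition hodge :: "nat \<Rightarrow> face \<Rightarrow> face \<Rightarrow> int" where
  "hodge n f f' = (\<Sum>g\<in>cube n. incidence f g * incidence f' g) + (\<Sum>g\<in>cube n. incidence g f * incidence g f')"

text \<open>The same matrix for the 1-cube.\<close>

definition edge_laplacian :: "coord \<Rightarrow> coord \<Rightarrow> int" where
  "edge_laplacian a b =
    (if a = CStar \<or> b = CStar then (if a = b then 2 else 0) else if a = b then 1 else - 1)"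

text \<open>The mixed terms cancel, since \<open>s\<close> anticommutes with \<open>d\<close> and with its transpose. What remains is
  \<open>L \<otimes> 1 + 1 \<otimes> L'\<close>, with \<open>L\<close> and \<open>L'\<close> the total Laplacians of the 1-cube and of \<open>Q\<^sub>n\<close>, so the
  coordinates of the cube do not interact.\<close>

lemma hodge_Cons:
  assumes "f \<in> cube n" "f' \<in> cube n"
  shows "hodge (Suc n) (a # f) (a' # f') =
    (if f = f' then edge_laplacian a a' else 0) + (if a = a' then hodge n f f' else 0)"
proof -
  let ?s = "\<lambda>c. if c = CStar then - 1 else (1 :: int)"
  have up: "incidence (a # f) (b # g) * incidence (a' # f') (b # g) =
     (if g = f then facet_sign a b * (if f = f' then facet_sign a' b else 0) +
        facet_sign a b * (if a' = b then ?s b * incidence f' f else 0) else 0)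
     + (if g = f' then facet_sign a' b * (if a = b then ?s b * incidence f f' else 0) else 0)
     + (if a = b \<and> a' = b then incidence f g * incidence f' g else 0)" if "g \<in> cube n" for b g
    using assms that by (auto simp: incidence_Cons cube_def algebra_simps)
  have down: "incidence (b # g) (a # f) * incidence (b # g) (a' # f') =
     (if g = f then facet_sign b a * (if f = f' then facet_sign b a' else 0) +
        facet_sign b a * (if a' = b then ?s b * incidence f f' else 0) else 0)
     + (if g = f' then facet_sign b a' * (if a = b then ?s b * incidence f' f else 0) else 0)
     + (if a = b \<and> a' = b then incidence g f * incidence g f' else 0)" if "g \<in> cube n" for b g
    using assms that by (auto simp: incidence_Cons cube_def algebra_simps)
  show ?thesis
    using assms
    by (simp add: hodge_def sum_cube_Suc up down sum.distrib split del: if_split;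
        cases a; cases a'; simp add: facet_sign_def edge_laplacian_def hodge_def)
qed

text \<open>An orthogonal eigenbasis of the Laplacian of the 1-cube, labelled by the faces of the 1-cube: the sum
  of the two vertices has eigenvalue 0, while their difference and the edge have eigenvalue 2. Only the
  third vector lives on the edge, so the label has the same dimension as the chain.\<close>

fun edge_eigenvec :: "coord \<Rightarrow> coord \<Rightarrow> int" where
  "edge_eigenvec C0 a = (if a = CStar then 0 else 1)"
| "edge_eigenvec C1 a = (case a of C0 \<Rightarrow> -1 | C1 \<Rightarrow> 1 | CStar \<Rightarrow> 0)"
| "edge_eigenvec CStar a = (if a = CStar then 1 else 0)"

text \<open>Meant for lists of the same length; the last equation is then the empty product.\<close>

fun tensor_eigenvec :: "face \<Rightarrow> face \<Rightarrow> int" where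
  "tensor_eigenvec (c # h) (a # f) = edge_eigenvec c a * tensor_eigenvec h f"
| "tensor_eigenvec _ _ = 1"

text \<open>Each label other than \<open>C0\<close> contributes 2 to the eigenvalue.\<close>

definition weight :: "face \<Rightarrow> nat" where
  "weight h = length (filter (\<lambda>c. c \<noteq> C0) h)"

lemma hodge_tensor_eigenvec:
  assumes "f \<in> cube n" "h \<in> cube n"
  shows "(\<Sum>f'\<in>cube n. hodge n f f' * tensor_eigenvec h f') = 2 * int (weight h) * tensor_eigenvec h f"
  using assms
proof (induction n arbitrary: f h)
  case 0
  then show ?case by (simp add: cube_0 hodge_def weight_def)
next
  case (Suc n)
  obtain a f\<^sub>0 where f: "f = a # f\<^sub>0" "f\<^sub>0 \<in> cube n"
    using Suc.prems by (auto simp: cube_Suc)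
  obtain c h\<^sub>0 where h: "h = c # h\<^sub>0" "h\<^sub>0 \<in> cube n"
    using Suc.prems by (auto simp: cube_Suc)
  have *: "hodge (Suc n) (a # f\<^sub>0) (b # f') * (edge_eigenvec c b * tensor_eigenvec h\<^sub>0 f') =
     (if f' = f\<^sub>0 then edge_laplacian a b * edge_eigenvec c b * tensor_eigenvec h\<^sub>0 f\<^sub>0 else 0) +
     (if a = b then edge_eigenvec c b else 0) * (hodge n f\<^sub>0 f' * tensor_eigenvec h\<^sub>0 f')"
    if "f' \<in> cube n" for b f'
    using f that by (auto simp: hodge_Cons algebra_simps)
  show ?case
    using Suc.IH[OF f(2) h(2)] f h
    by (simp add: sum_cube_Suc * sum.distrib sum_distrib_left[symmetric] split del: if_split;
        cases a; cases c; simp add: edge_laplacian_def weight_def algebra_simps)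
qed

lemma tensor_eigenvec_orthogonal:
  assumes "h \<in> cube n" "h' \<in> cube n"
  shows "(\<Sum>f\<in>cube n. tensor_eigenvec h f * tensor_eigenvec h' f) = (if h = h' then 2 ^ (n - face_dim h) else 0)"
  using assms
proof (induction n arbitrary: h h')
  case 0
  then show ?case by (simp add: cube_0)
next
  case (Suc n)
  obtain c h\<^sub>0 where h: "h = c # h\<^sub>0" "h\<^sub>0 \<in> cube n"
    using Suc.prems by (auto simp: cube_Suc)
  obtain c' h\<^sub>1 where h': "h' = c' # h\<^sub>1" "h\<^sub>1 \<in> cube n"
    using Suc.prems by (auto simp: cube_Suc)
  have "Suc n - face_dim h\<^sub>0 = Suc (n - face_dim h\<^sub>0)"
    using face_dim_le_length[of h\<^sub>0] h by (simp add: cube_def Suc_diff_le)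
  moreover have "(edge_eigenvec c b * tensor_eigenvec h\<^sub>0 f) * (edge_eigenvec c' b * tensor_eigenvec h\<^sub>1 f) =
      (edge_eigenvec c b * edge_eigenvec c' b) * (tensor_eigenvec h\<^sub>0 f * tensor_eigenvec h\<^sub>1 f)" for b f
    by (simp add: algebra_simps)
  ultimately show ?case
    using Suc.IH[OF h(2) h'(2)] h h'
    by (cases "h\<^sub>0 = h\<^sub>1"; cases c; cases c') (simp_all add: sum_cube_Suc sum_distrib_left[symmetric] sum_negf)
qed

text \<open>Restricting the labels to the \<open>k\<close>-dimensional faces therefore gives vectors in \<open>C\<^sub>k\<close>, in the right
  number for a basis.\<close>

lemma tensor_eigenvec_support:
  "\<lbrakk>length f = length h; tensor_eigenvec h f \<noteq> 0\<rbrakk> \<Longrightarrow> face_dim f = face_dim h"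
proof (induction f h rule: list_induct2)
  case (Cons a f c h)
  then show ?case by (cases a; cases c) auto
qed simp

section \<open>Characteristic polynomials of sums and products\<close>

lemma char_poly_matrix_eq:
  assumes "A \<in> carrier_mat n n"
  shows "char_poly_matrix A = [:0, 1:] \<cdot>\<^sub>m 1\<^sub>m n - map_mat (\<lambda>a. [:a:]) A"
  using assms by (intro eq_matI) (auto simp: char_poly_matrix_def)

lemma const_mat_mult:
  fixes A B :: "'a :: comm_ring_1 mat"
  assumes "A \<in> carrier_mat m n" "B \<in> carrier_mat n k"
  shows "map_mat (\<lambda>a. [:a:]) (A * B) = map_mat (\<lambda>a. [:a:]) A * map_mat (\<lambda>a. [:a:]) B"
proof -
  interpret comm_ring_hom "\<lambda>a :: 'a. [:a:]"
    by unfold_locales (auto simp: one_pCons)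
  show ?thesis
    using mat_hom_mult[OF assms] .
qed

text \<open>Because \<open>A B = 0\<close>, the product \<open>(x - A) (x - B)\<close> equals \<open>x (x - (A + B))\<close>. Take determinants.\<close>

lemma char_poly_add_mult_0:
  fixes A B :: "'a :: idom mat"
  assumes A: "A \<in> carrier_mat n n" and B: "B \<in> carrier_mat n n" and AB: "A * B = 0\<^sub>m n n"
  shows "char_poly A * char_poly B = [:0, 1:] ^ n * char_poly (A + B)"
proof -
  let ?c = "map_mat (\<lambda>a. [:a:])" and ?X = "[:0, 1:] :: 'a poly"
  have "?c A * ?c B = ?c (A * B)"
    using const_mat_mult[OF A B] by simp
  also have "\<dots> = 0\<^sub>m n n"
    by (intro eq_matI) (auto simp: AB)
  finally have c: "?c A * ?c B = 0\<^sub>m n n" .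
  have "char_poly_matrix A * char_poly_matrix B =
      (?X \<cdot>\<^sub>m 1\<^sub>m n) * char_poly_matrix B - ?c A * char_poly_matrix B"
    using A B by (simp add: char_poly_matrix_eq[OF A] minus_mult_distrib_mat[of _ n n _ _ n])
  also have "?c A * char_poly_matrix B = ?c A * (?X \<cdot>\<^sub>m 1\<^sub>m n) - ?c A * ?c B"
    using A B by (simp add: char_poly_matrix_eq[OF B] mult_minus_distrib_mat[of _ n n _ n])
  also have "?c A * (?X \<cdot>\<^sub>m 1\<^sub>m n) = ?X \<cdot>\<^sub>m ?c A"
    using A by (simp add: mult_smult_distrib[of _ n n _ n])
  also have "(?X \<cdot>\<^sub>m 1\<^sub>m n) * char_poly_matrix B = ?X \<cdot>\<^sub>m char_poly_matrix B"
    using B by (simp add: mult_smult_assoc_mat[of _ n n _ n] left_mult_one_mat[OF char_poly_matrix_closed[OF B]])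
  also have "\<dots> - (?X \<cdot>\<^sub>m ?c A - ?c A * ?c B) = ?X \<cdot>\<^sub>m char_poly_matrix (A + B)"
    using A B by (intro eq_matI) (auto simp: c char_poly_matrix_def)
  finally have "det (char_poly_matrix A * char_poly_matrix B) = ?X ^ n * char_poly (A + B)"
    using carrier_matD(2)[OF char_poly_matrix_closed[of "A + B" n]] A B by (simp add: char_poly_def)
  then show ?thesis
    using A B by (simp add: det_mult[of _ n] char_poly_def)
qed

text \<open>Both sides arise from the determinant of the block matrix \<open>M\<close> with rows \<open>(x, A)\<close> and \<open>(B, 1)\<close>: one
  multiplication on the right clears the lower left block and leaves \<open>x - A B\<close>, another clears the upper
  right block and leaves \<open>x - B A\<close>.\<close>

lemma char_poly_mult_commute:
  fixes A B :: "'a :: idom mat"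
  assumes A: "A \<in> carrier_mat m n" and B: "B \<in> carrier_mat n m"
  shows "[:0, 1:] ^ n * char_poly (A * B) = [:0, 1:] ^ m * char_poly (B * A)"
proof -
  let ?c = "map_mat (\<lambda>a. [:a:])" and ?X = "[:0, 1:] :: 'a poly"
  let ?M = "four_block_mat (?X \<cdot>\<^sub>m 1\<^sub>m m) (?c A) (?c B) (1\<^sub>m n)"
  let ?L = "four_block_mat (1\<^sub>m m) (0\<^sub>m m n) (- ?c B) (1\<^sub>m n)"
  let ?R = "four_block_mat (1\<^sub>m m) (- ?c A) (0\<^sub>m n m) (?X \<cdot>\<^sub>m 1\<^sub>m n)"
  have cA [simp]: "?c A \<in> carrier_mat m n" and cB [simp]: "?c B \<in> carrier_mat n m"
    and M [simp]: "?M \<in> carrier_mat (m + n) (m + n)"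
    using A B by auto
  have AB: "char_poly_matrix (A * B) = ?X \<cdot>\<^sub>m 1\<^sub>m m + - (?c A * ?c B)"
    using A B
    by (simp add: char_poly_matrix_eq[of _ m] const_mat_mult[OF A B] minus_add_uminus_mat[of _ m m])
  have BA: "char_poly_matrix (B * A) = - (?c B * ?c A) + ?X \<cdot>\<^sub>m 1\<^sub>m n"
    using A B
    by (simp add: char_poly_matrix_eq[of _ n] const_mat_mult[OF B A] minus_add_uminus_mat[of _ n n]
        comm_add_mat[of _ n n])
  have "?M * ?L = four_block_mat (char_poly_matrix (A * B)) (?c A) (0\<^sub>m n m) (1\<^sub>m n)"
    using A B by (subst mult_four_block_mat[of _ m m _ n _ n _ _ m _ n]) (auto simp: AB)
  then have "det (?M * ?L) = char_poly (A * B)"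
    using A B by (simp add: det_four_block_mat_lower_left_zero[of _ m _ n] char_poly_def del: map_carrier_mat)
  moreover have "det ?L = 1"
    using B by (subst det_four_block_mat_upper_right_zero[of _ m _ n]) auto
  ultimately have 1: "det ?M = char_poly (A * B)"
    by (simp add: det_mult[of _ "m + n"])
  have "?M * ?R = four_block_mat (?X \<cdot>\<^sub>m 1\<^sub>m m) (0\<^sub>m m n) (?c B) (char_poly_matrix (B * A))"
    using A B
    by (subst mult_four_block_mat[of _ m m _ n _ n _ _ m _ n])
      (auto simp: BA mult_smult_distrib[of _ m n _ n] mult_smult_assoc_mat[of _ m m _ n]
        uminus_l_inv_mat[of _ m n])
  then have "det (?M * ?R) = ?X ^ m * char_poly (B * A)"
    using A B by (simp add: det_four_block_mat_upper_right_zero[of _ m _ n] char_poly_def)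
  moreover have "det ?R = ?X ^ n"
    using A by (subst det_four_block_mat_lower_left_zero[of _ m _ n]) auto
  ultimately show ?thesis
    by (simp add: det_mult[of _ "m + n"] 1 mult.commute)
qed

text \<open>The columns of \<open>P\<close> are eigenvectors, and the left inverse \<open>Q\<close> certifies that they form a basis.\<close>

lemma char_poly_eigenbasis:
  fixes A P Q :: "'a :: field mat"
  assumes A: "A \<in> carrier_mat n n" and P: "P \<in> carrier_mat n n" and Q: "Q \<in> carrier_mat n n"
    and QP: "Q * P = 1\<^sub>m n"
    and AP: "A * P = P * mat_diag n d"
  shows "char_poly A = (\<Prod>a\<leftarrow>map d [0..<n]. [:- a, 1:])"
proof -
  have PQ: "P * Q = 1\<^sub>m n"
    using mat_mult_left_right_inverse[OF Q P QP] .
  have "A = A * (P * Q)"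
    using A by (simp add: PQ)
  also have "\<dots> = A * P * Q"
    using A P Q by simp
  finally have "A = P * mat_diag n d * Q"
    by (simp add: AP)
  then have "similar_mat_wit A (mat_diag n d) P Q"
    using A P Q PQ QP by (intro similar_mat_witI[of _ _ n]) auto
  then have "char_poly A = char_poly (mat_diag n d)"
    by (intro char_poly_similar) (auto simp: similar_mat_def)
  also have "\<dots> = (\<Prod>a\<leftarrow>diag_mat (mat_diag n d). [:- a, 1:])"
    by (rule char_poly_upper_triangular[of _ n]) (auto simp: mat_diag_def)
  also have "diag_mat (mat_diag n d) = map d [0..<n]"
    by (auto simp: diag_mat_def mat_diag_def)
  finally show ?thesis
    .
qed

section \<open>Multiplicities of nonzero eigenvalues\<close>

lemma proots_prod_linear: "proots (\<Prod>a\<leftarrow>as. [:- a, 1:]) = mset (as :: 'a :: idom list)"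
proof (induction as)
  case (Cons a as)
  have "(\<Prod>a\<leftarrow>as. [:- a, 1:]) \<noteq> 0"
    by (auto simp: prod_list_zero_iff)
  then show ?case
    using Cons by (simp add: proots_mult del: mult_pCons_left)
qed simp

lemma char_poly_nonzero:
  fixes A :: "'a :: idom mat"
  assumes "A \<in> carrier_mat n n"
  shows "char_poly A \<noteq> 0"
  using degree_monic_char_poly[OF assms] by auto

lemma order_power_X:
  fixes \<mu> :: "'a :: idom"
  assumes "\<mu> \<noteq> 0"
  shows "order \<mu> ([:0, 1:] ^ n) = 0"
  using assms by (intro order_0I) simp

lemma count_eigenvalue_mset:
  assumes "A \<in> carrier_mat n n"
  shows "count (eigenvalue_mset A) \<mu> = order \<mu> (char_poly (map_mat complex_of_int A))"
  using assms by (simp add: eigenvalue_mset_def char_poly_nonzero[of _ n])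

lemma count_eigenvalue_mset_add:
  assumes A: "A \<in> carrier_mat n n" and B: "B \<in> carrier_mat n n" and AB: "A * B = 0\<^sub>m n n" and "\<mu> \<noteq> 0"
  shows "count (eigenvalue_mset (A + B)) \<mu> = count (eigenvalue_mset A) \<mu> + count (eigenvalue_mset B) \<mu>"
proof -
  let ?A = "map_mat complex_of_int A" and ?B = "map_mat complex_of_int B"
  have "?A * ?B = map_mat of_int (A * B)"
    by (rule of_int_hom.mat_hom_mult[OF A B, symmetric])
  also have "\<dots> = 0\<^sub>m n n"
    by (intro eq_matI) (auto simp: AB)
  finally have "char_poly ?A * char_poly ?B = [:0, 1:] ^ n * char_poly (?A + ?B)"
    using A B by (intro char_poly_add_mult_0) auto
  also have "?A + ?B = map_mat of_int (A + B)"
    using A B by (intro eq_matI) auto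
  finally have "order \<mu> (char_poly ?A * char_poly ?B) =
      order \<mu> ([:0, 1:] ^ n * char_poly (map_mat complex_of_int (A + B)))"
    by simp
  then show ?thesis
    using A B \<open>\<mu> \<noteq> 0\<close>
    by (simp add: order_mult char_poly_nonzero[of _ n] count_eigenvalue_mset[of _ n] order_power_X)
qed

lemma count_eigenvalue_mset_mult_commute:
  assumes A: "A \<in> carrier_mat m n" and B: "B \<in> carrier_mat n m" and "\<mu> \<noteq> 0"
  shows "count (eigenvalue_mset (A * B)) \<mu> = count (eigenvalue_mset (B * A)) \<mu>"
proof -
  let ?A = "map_mat complex_of_int A" and ?B = "map_mat complex_of_int B"
  have "[:0, 1:] ^ n * char_poly (?A * ?B) = [:0, 1:] ^ m * char_poly (?B * ?A)"
    using A B by (intro char_poly_mult_commute) auto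
  then have "order \<mu> ([:0, 1:] ^ n * char_poly (?A * ?B)) = order \<mu> ([:0, 1:] ^ m * char_poly (?B * ?A))"
    by simp
  moreover have "char_poly (?A * ?B) \<noteq> 0" "char_poly (?B * ?A) \<noteq> 0"
    using A B by (intro char_poly_nonzero[of _ m] char_poly_nonzero[of _ n], simp)+
  ultimately have "order \<mu> (char_poly (?A * ?B)) = order \<mu> (char_poly (?B * ?A))"
    using \<open>\<mu> \<noteq> 0\<close> by (simp add: order_mult order_power_X)
  then show ?thesis
    using A B
    by (simp add: count_eigenvalue_mset[of _ n] count_eigenvalue_mset[of _ m]
        of_int_hom.mat_hom_mult[OF A B] of_int_hom.mat_hom_mult[OF B A])
qed

text \<open>Additivity for \<open>0 = 0 + 0\<close> makes the multiplicity equal to its double.\<close>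

lemma eigenvalue_mset_zero_mat: "\<mu> \<noteq> 0 \<Longrightarrow> count (eigenvalue_mset (0\<^sub>m n n)) \<mu> = 0"
  using count_eigenvalue_mset_add[of "0\<^sub>m n n" n "0\<^sub>m n n" \<mu>] by simp

section \<open>The spectra of the cube\<close>

text \<open>Passes from sums over the matrix indices of one dimension, in which products of matrices are given, to
  sums over all faces, in which the induction on the cube takes place.\<close>

lemma sum_face_list:
  assumes "\<And>f. \<lbrakk>f \<in> cube n; F f \<noteq> 0\<rbrakk> \<Longrightarrow> face_dim f = k"
  shows "(\<Sum>i = 0..<length (face_list n (cube n) k). F (face_list n (cube n) k ! i)) = (\<Sum>f\<in>cube n. F f)"
proof -
  let ?xs = "face_list n (cube n) k"
  have "(\<Sum>i = 0..<length ?xs. F (?xs ! i)) = (\<Sum>f\<in>set ?xs. F f)"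
    by (intro sum.reindex_bij_betw bij_betw_nth) (auto simp: distinct_face_list atLeast0LessThan)
  also have "\<dots> = (\<Sum>f\<in>cube n. F f)"
    using assms by (intro sum.mono_neutral_left) (auto simp: set_face_list)
  finally show ?thesis .
qed

lemma nth_face_list:
  assumes "i < length (face_list n X k)"
  shows "face_list n X k ! i \<in> cube n" "face_dim (face_list n X k ! i) = k"
  using nth_mem[OF assms] by (auto simp: set_face_list)

lemma boundary_carrier:
  "boundary n X i \<in> carrier_mat (if i = 0 then 0 else length (face_list n X (i - 1))) (length (face_list n X i))"
  by (cases i) auto

lemma boundary_Suc_carrier:
  "boundary n X (Suc i) \<in> carrier_mat (length (face_list n X i)) (length (face_list n X (Suc i)))"
  by simp

lemma lap_carrier:
  "lap_ud n X i \<in> carrier_mat (length (face_list n X i)) (length (face_list n X i))"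
  "lap_du n X i \<in> carrier_mat (length (face_list n X i)) (length (face_list n X i))"
  using boundary_carrier[of n X i] by (auto simp: lap_ud_def lap_du_def)

lemma laplacian_carrier:
  "laplacian b n X i \<in> carrier_mat (length (face_list n X i)) (length (face_list n X i))"
  using lap_carrier by (cases b) auto

lemma incidence_dim: "incidence f g \<noteq> 0 \<Longrightarrow> face_dim g = face_dim f + 1"
  using incidence_eq_0 by blast

lemma laplacian_Tot_cube_nth:
  assumes "p < length (face_list n (cube n) k)" "q < length (face_list n (cube n) k)"
  shows "laplacian Tot n (cube n) k $$ (p, q) =
    hodge n (face_list n (cube n) k ! p) (face_list n (cube n) k ! q)"
proof -
  let ?f = "face_list n (cube n) k ! p" and ?f' = "face_list n (cube n) k ! q"
  note dims = nth_face_list[OF assms(1)] nth_face_list[OF assms(2)]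
  have "lap_ud n (cube n) k $$ (p, q) = (\<Sum>i = 0..<length (face_list n (cube n) (Suc k)).
      incidence ?f (face_list n (cube n) (Suc k) ! i) * incidence ?f' (face_list n (cube n) (Suc k) ! i))"
    using assms by (simp add: lap_ud_def scalar_prod_def)
  also have "\<dots> = (\<Sum>g\<in>cube n. incidence ?f g * incidence ?f' g)"
    using dims by (intro sum_face_list) (auto dest: incidence_dim)
  finally have ud: "lap_ud n (cube n) k $$ (p, q) = (\<Sum>g\<in>cube n. incidence ?f g * incidence ?f' g)" .
  have du: "lap_du n (cube n) k $$ (p, q) = (\<Sum>g\<in>cube n. incidence g ?f * incidence g ?f')"
  proof (cases k)
    case 0
    then have "incidence g ?f = 0" for g
      using dims incidence_dim[of g ?f] by auto
    then show ?thesis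
      using assms 0 by (simp add: lap_du_def scalar_prod_def)
  next
    case (Suc i)
    have "lap_du n (cube n) k $$ (p, q) = (\<Sum>r = 0..<length (face_list n (cube n) i).
      incidence (face_list n (cube n) i ! r) ?f * incidence (face_list n (cube n) i ! r) ?f')"
      using assms by (simp add: lap_du_def scalar_prod_def Suc)
    also have "\<dots> = (\<Sum>g\<in>cube n. incidence g ?f * incidence g ?f')"
      using dims by (intro sum_face_list) (auto dest!: incidence_dim simp: Suc)
    finally show ?thesis .
  qed
  show ?thesis
    using assms lap_carrier[of n "cube n" k] ud du by (simp add: hodge_def)
qed

text \<open>The tensor eigenvectors labelled by the \<open>k\<close>-faces are the columns of \<open>P\<close>. They all have squared norm
  \<open>2 ^ (n - k)\<close>, so the transpose of \<open>P\<close>, divided by that number, is its inverse \<open>Q\<close>.\<close>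

lemma spec_Tot_cube:
  "spec Tot n (cube n) k = image_mset (\<lambda>h. of_nat (2 * weight h)) (mset (face_list n (cube n) k))"
proof -
  let ?xs = "face_list n (cube n) k"
  let ?N = "length ?xs" and ?ev = "\<lambda>h. of_nat (2 * weight h) :: complex"
  let ?A = "map_mat complex_of_int (laplacian Tot n (cube n) k)"
  let ?P = "mat ?N ?N (\<lambda>(p, q). complex_of_int (tensor_eigenvec (?xs ! q) (?xs ! p)))"
  let ?Q = "mat ?N ?N (\<lambda>(p, q). complex_of_int (tensor_eigenvec (?xs ! p) (?xs ! q)) / 2 ^ (n - k))"
  have support: "face_dim f = k" if "tensor_eigenvec (?xs ! q) f \<noteq> 0" "f \<in> cube n" "q < ?N" for f q
    using that nth_face_list[OF that(3)] tensor_eigenvec_support[of f "?xs ! q"] by (simp add: cube_def)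
  have A: "?A \<in> carrier_mat ?N ?N"
    using laplacian_carrier[of Tot n "cube n" k] by simp
  have inj: "?xs ! p = ?xs ! q \<longleftrightarrow> p = q" if "p < ?N" "q < ?N" for p q
    using that by (simp add: nth_eq_iff_index_eq distinct_face_list)
  have QP: "?Q * ?P = 1\<^sub>m ?N"
  proof (intro eq_matI)
    fix p q assume "p < dim_row (1\<^sub>m ?N)" "q < dim_col (1\<^sub>m ?N)"
    then have pq: "p < ?N" "q < ?N" by auto
    have "(?Q * ?P) $$ (p, q) = (\<Sum>i = 0..<?N.
        of_int (tensor_eigenvec (?xs ! p) (?xs ! i) * tensor_eigenvec (?xs ! q) (?xs ! i)) / 2 ^ (n - k))"
      using pq by (simp add: scalar_prod_def)
    also have "\<dots> = of_int (\<Sum>f\<in>cube n. tensor_eigenvec (?xs ! p) f * tensor_eigenvec (?xs ! q) f) / 2 ^ (n - k)"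
      using pq support by (subst sum_face_list[symmetric, of _ _ k])
        (auto simp: sum_divide_distrib)
    also have "\<dots> = 1\<^sub>m ?N $$ (p, q)"
      using pq nth_face_list[OF pq(1)] nth_face_list[OF pq(2)]
      by (simp add: tensor_eigenvec_orthogonal inj)
    finally show "(?Q * ?P) $$ (p, q) = 1\<^sub>m ?N $$ (p, q)" .
  qed auto
  have AP: "?A * ?P = ?P * mat_diag ?N (\<lambda>i. ?ev (?xs ! i))"
  proof (intro eq_matI)
    fix p q assume "p < dim_row (?P * mat_diag ?N (\<lambda>i. ?ev (?xs ! i)))"
      "q < dim_col (?P * mat_diag ?N (\<lambda>i. ?ev (?xs ! i)))"
    then have pq: "p < ?N" "q < ?N" by (auto simp: mat_diag_def)
    have "(?A * ?P) $$ (p, q) = (\<Sum>i = 0..<?N.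
        of_int (hodge n (?xs ! p) (?xs ! i) * tensor_eigenvec (?xs ! q) (?xs ! i)))"
      using pq A laplacian_Tot_cube_nth[of p n k] by (simp add: scalar_prod_def del: laplacian.simps)
    also have "\<dots> = of_int (\<Sum>f\<in>cube n. hodge n (?xs ! p) f * tensor_eigenvec (?xs ! q) f)"
      using pq support by (subst sum_face_list[symmetric, of _ _ k]) auto
    also have "\<dots> = of_int (tensor_eigenvec (?xs ! q) (?xs ! p)) * ?ev (?xs ! q)"
      using nth_face_list[OF pq(1)] nth_face_list[OF pq(2)] by (simp add: hodge_tensor_eigenvec)
    also have "\<dots> = (?P * mat_diag ?N (\<lambda>i. ?ev (?xs ! i))) $$ (p, q)"
      using pq by (simp add: mat_diag_mult_right[of _ ?N])
    finally show "(?A * ?P) $$ (p, q) = (?P * mat_diag ?N (\<lambda>i. ?ev (?xs ! i))) $$ (p, q)" .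
  qed (use A in \<open>auto simp: mat_diag_def\<close>)
  have "char_poly ?A = (\<Prod>a\<leftarrow>map (\<lambda>i. ?ev (?xs ! i)) [0..<?N]. [:- a, 1:])"
    by (rule char_poly_eigenbasis[OF A _ _ QP AP]) auto
  then have "spec Tot n (cube n) k = mset (map (\<lambda>i. ?ev (?xs ! i)) [0..<?N])"
    unfolding spec_def eigenvalue_mset_def by (simp only: proots_prod_linear)
  also have "map (\<lambda>i. ?ev (?xs ! i)) [0..<?N] = map ?ev ?xs"
    by (intro nth_equalityI) auto
  finally show ?thesis
    by simp
qed

lemma boundary_mult_boundary:
  "boundary n (cube n) (Suc k) * boundary n (cube n) (Suc (Suc k)) =
    0\<^sub>m (length (face_list n (cube n) k)) (length (face_list n (cube n) (Suc (Suc k))))"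
proof (intro eq_matI)
  fix p q assume "p < dim_row (0\<^sub>m (length (face_list n (cube n) k)) (length (face_list n (cube n) (Suc (Suc k)))))"
    "q < dim_col (0\<^sub>m (length (face_list n (cube n) k)) (length (face_list n (cube n) (Suc (Suc k)))))"
  then have pq: "p < length (face_list n (cube n) k)" "q < length (face_list n (cube n) (Suc (Suc k)))"
    by auto
  let ?f = "face_list n (cube n) k ! p" and ?h = "face_list n (cube n) (Suc (Suc k)) ! q"
  note dims = nth_face_list[OF pq(1)] nth_face_list[OF pq(2)]
  have "(boundary n (cube n) (Suc k) * boundary n (cube n) (Suc (Suc k))) $$ (p, q) =
    (\<Sum>i = 0..<length (face_list n (cube n) (Suc k)).
      incidence ?f (face_list n (cube n) (Suc k) ! i) * incidence (face_list n (cube n) (Suc k) ! i) ?h)"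
    using pq by (simp add: scalar_prod_def)
  also have "\<dots> = (\<Sum>g\<in>cube n. incidence ?f g * incidence g ?h)"
    using dims by (intro sum_face_list) (auto dest: incidence_dim)
  also have "\<dots> = 0"
    using dims by (intro boundary_boundary)
  finally show "(boundary n (cube n) (Suc k) * boundary n (cube n) (Suc (Suc k))) $$ (p, q) =
      0\<^sub>m (length (face_list n (cube n) k)) (length (face_list n (cube n) (Suc (Suc k)))) $$ (p, q)"
    using pq by simp
qed auto

text \<open>The two inner factors multiply to the transpose of \<open>\<partial>\<^sub>k \<partial>\<^sub>k\<^sub>+\<^sub>1\<close>, which is zero. For \<open>k = 0\<close> the
  second Laplacian vanishes by itself.\<close>

lemma lap_ud_mult_lap_du:
  "lap_ud n (cube n) k * lap_du n (cube n) k =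
    0\<^sub>m (length (face_list n (cube n) k)) (length (face_list n (cube n) k))"
proof (cases k)
  case 0
  let ?N = "length (face_list n (cube n) 0)"
  have "lap_du n (cube n) k = 0\<^sub>m ?N ?N"
    using 0 by (intro eq_matI) (auto simp: lap_du_def scalar_prod_def)
  then show ?thesis
    using lap_carrier(1)[of n "cube n" k] 0 by (simp add: right_mult_zero_mat)
next
  case (Suc i)
  let ?N = "\<lambda>j. length (face_list n (cube n) j)"
  let ?D = "boundary n (cube n) (Suc (Suc i))" and ?d = "boundary n (cube n) (Suc i)"
  have D: "?D \<in> carrier_mat (?N (Suc i)) (?N (Suc (Suc i)))" and d: "?d \<in> carrier_mat (?N i) (?N (Suc i))"
    using boundary_Suc_carrier by blast+
  have Dd: "?D\<^sup>T * ?d\<^sup>T = 0\<^sub>m (?N (Suc (Suc i))) (?N i)"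
    using transpose_mult[OF d D] by (simp add: boundary_mult_boundary del: boundary.simps)
  have "lap_ud n (cube n) k * lap_du n (cube n) k = (?D * ?D\<^sup>T) * (?d\<^sup>T * ?d)"
    by (simp add: lap_ud_def lap_du_def Suc del: boundary.simps)
  also have "\<dots> = ?D * ((?D\<^sup>T * ?d\<^sup>T) * ?d)"
    using D d by (simp add: assoc_mult_mat[of _ "?N (Suc i)" "?N (Suc (Suc i))" _ "?N (Suc i)" _ "?N (Suc i)"]
      assoc_mult_mat[of _ "?N (Suc (Suc i))" "?N (Suc i)" _ "?N i" _ "?N (Suc i)"] del: boundary.simps)
  also have "\<dots> = 0\<^sub>m (?N k) (?N k)"
    using D d by (simp add: Dd Suc left_mult_zero_mat right_mult_zero_mat del: boundary.simps)
  finally show ?thesis .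
qed

lemma count_spec_Tot_cube:
  assumes "\<mu> \<noteq> 0"
  shows "count (spec Tot n (cube n) k) \<mu> = count (spec UD n (cube n) k) \<mu> + count (spec DU n (cube n) k) \<mu>"
  unfolding spec_def laplacian.simps
  using count_eigenvalue_mset_add[OF lap_carrier lap_ud_mult_lap_du assms] .

lemma count_spec_DU_Suc:
  assumes "\<mu> \<noteq> 0"
  shows "count (spec DU n X (Suc k)) \<mu> = count (spec UD n X k) \<mu>"
  unfolding spec_def laplacian.simps lap_ud_def lap_du_def
  using count_eigenvalue_mset_mult_commute[OF _ boundary_Suc_carrier assms, of "(boundary n X (Suc k))\<^sup>T"]
  by simp

lemma count_spec_DU_0: "\<mu> \<noteq> 0 \<Longrightarrow> count (spec DU n X 0) \<mu> = 0"
proof -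
  assume "\<mu> \<noteq> 0"
  moreover have "lap_du n X 0 = 0\<^sub>m (length (face_list n X 0)) (length (face_list n X 0))"
    by (intro eq_matI) (auto simp: lap_du_def scalar_prod_def)
  ultimately show ?thesis
    by (simp add: spec_def eigenvalue_mset_zero_mat)
qed

text \<open>Choose the \<open>j\<close> positions that are not \<open>C0\<close>, and among them the \<open>k\<close> asterisks.\<close>

lemma card_dim_weight:
  "card {h \<in> cube n. face_dim h = k \<and> weight h = j} = (n choose j) * (j choose k)"
proof -
  have "(\<Sum>h\<in>cube n. if face_dim h = k \<and> weight h = j then 1 else 0) = (n choose j) * (j choose k)"
  proof (induction n arbitrary: k j)
    case 0
    then show ?case by (cases j; cases k) (auto simp: cube_0 weight_def)
  next
    case (Suc n)
    have "weight (a # h) = (if a = C0 then 0 else 1) + weight h" for a h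
      by (simp add: weight_def)
    then show ?case
      using Suc.IH by (cases j; cases k) (simp_all add: sum_cube_Suc algebra_simps)
  qed
  then show ?thesis
    by (simp add: sum.If_cases Int_def)
qed

lemma count_spec_Tot_cube_even:
  "count (spec Tot n (cube n) k) (of_nat (2 * j)) = (n choose j) * (j choose k)"
proof -
  have "count (spec Tot n (cube n) k) (of_nat (2 * j)) =
      card {h \<in> set (face_list n (cube n) k). weight h = j}"
    by (auto simp: spec_Tot_cube count_image_mset distinct_count_atmost_1[THEN iffD1, OF distinct_face_list]
        simp flip: card_eq_sum intro!: arg_cong[where f = card])
  also have "\<dots> = (n choose j) * (j choose k)"
    by (simp add: set_face_list conj_ac flip: card_dim_weight)
  finally show ?thesis .
qed

text \<open>The multiplicity in dimension \<open>k\<close> of the total Laplacian is the sum of those of the up-down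
  Laplacians in dimensions \<open>k\<close> and \<open>k - 1\<close>. With \<open>(n choose j) * (j choose k)\<close> on the left, Pascal's rule
  solves this recurrence.\<close>

lemma count_spec_UD_cube_even:
  assumes "j \<ge> 1"
  shows "count (spec UD n (cube n) k) (of_nat (2 * j)) = (n choose j) * ((j - 1) choose k)"
proof -
  have nz: "of_nat (2 * j) \<noteq> (0 :: complex)"
    using assms unfolding of_nat_eq_0_iff by simp
  obtain i where j: "j = Suc i"
    using assms by (cases j) auto
  note Tot = count_spec_Tot_cube[OF nz, of n, unfolded count_spec_Tot_cube_even]
  show ?thesis
  proof (induction k)
    case 0
    show ?case
      using Tot[of 0] count_spec_DU_0[OF nz, of n "cube n"] by simp
  next
    case (Suc k)
    show ?case
      using Tot[of "Suc k"] count_spec_DU_Suc[OF nz, of n "cube n" k] Suc.IH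
      by (simp add: j algebra_simps)
  qed
qed

text \<open>A nonzero eigenvalue of either partial Laplacian is also one of the total Laplacian.\<close>

lemma spec_cube_even:
  assumes "\<mu> \<in># spec b n (cube n) k"
  shows "\<exists>j. \<mu> = of_nat (2 * j)"
proof (cases "\<mu> = 0")
  case False
  have "count (spec b n (cube n) k) \<mu> \<le> count (spec Tot n (cube n) k) \<mu>"
    using count_spec_Tot_cube[OF False] by (cases b) auto
  then have "\<mu> \<in># spec Tot n (cube n) k"
    using assms by (simp flip: count_greater_zero_iff)
  then show ?thesis
    by (auto simp: spec_Tot_cube)
qed (auto intro: exI[of _ 0])

lemma laplacian_integral_cube: "laplacian_integral n (cube n)"
  unfolding laplacian_integral_def using spec_cube_even by (metis Ints_of_nat)

section \<open>Integrality for the skeletons\<close>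

lemma face_list_skeleton:
  "face_list n (skeleton k n) i = (if i \<le> k then face_list n (cube n) i else [])"
  by (auto simp: face_list_def skeleton_def filter_empty_conv intro: filter_cong)

lemma boundary_skeleton: "i \<le> k \<Longrightarrow> boundary n (skeleton k n) i = boundary n (cube n) i"
  by (cases i) (auto simp: face_list_skeleton)

lemma spec_skeleton_below: "i < k \<Longrightarrow> spec b n (skeleton k n) i = spec b n (cube n) i"
  by (cases b) (auto simp: spec_def lap_ud_def lap_du_def boundary_skeleton simp del: boundary.simps)

lemma lap_ud_skeleton_top:
  "lap_ud n (skeleton k n) k = 0\<^sub>m (length (face_list n (cube n) k)) (length (face_list n (cube n) k))"
  by (intro eq_matI) (auto simp: lap_ud_def scalar_prod_def face_list_skeleton)

lemma lap_du_skeleton: "i \<le> k \<Longrightarrow> lap_du n (skeleton k n) i = lap_du n (cube n) i"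
  by (simp add: lap_du_def boundary_skeleton)

text \<open>In the top dimension there is nothing above, so the up-down part vanishes and the total Laplacian is
  the down-up Laplacian of the full cube.\<close>

lemma spec_skeleton_top:
  "spec b n (skeleton k n) k =
    (if b = UD then eigenvalue_mset (0\<^sub>m (length (face_list n (cube n) k)) (length (face_list n (cube n) k)))
     else spec DU n (cube n) k)"
  using lap_carrier(2)[of n "cube n" k]
  by (cases b) (auto simp: spec_def lap_ud_skeleton_top lap_du_skeleton)

text \<open>The matrix is empty.\<close>

lemma spec_skeleton_above:
  assumes "k < i"
  shows "spec b n (skeleton k n) i = {#}"
proof -
  let ?A = "map_mat complex_of_int (laplacian b n (skeleton k n) i)"
  have "?A \<in> carrier_mat 0 0"
    using laplacian_carrier[of b n "skeleton k n" i] assms by (simp add: face_list_skeleton)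
  then have "size (proots (char_poly ?A)) = 0"
    using size_proots_le[of "char_poly ?A"] degree_monic_char_poly[of ?A 0] by auto
  then show ?thesis
    by (simp add: spec_def eigenvalue_mset_def)
qed

lemma laplacian_integral_skeleton: "laplacian_integral n (skeleton k n)"
  unfolding laplacian_integral_def
proof (intro allI ballI)
  fix b i \<mu> assume \<mu>: "\<mu> \<in># spec b n (skeleton k n) i"
  show "\<mu> \<in> \<int>"
  proof (cases "\<mu> = 0 \<or> i \<noteq> k \<or> b \<noteq> UD")
    case True
    then have "\<mu> = 0 \<or> (\<exists>b. \<mu> \<in># spec b n (cube n) i)"
      using \<mu> spec_skeleton_below[of i k b n] spec_skeleton_above[of k i b n] spec_skeleton_top[of b n k]
      by (cases i k rule: linorder_cases) auto
    then show ?thesis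
      using laplacian_integral_cube[of n] by (auto simp: laplacian_integral_def)
  next
    case False
    then have "count (spec b n (skeleton k n) i) \<mu> = 0"
      by (simp add: spec_skeleton_top eigenvalue_mset_zero_mat)
    then show ?thesis
      using \<mu> by (simp add: count_eq_zero_iff)
  qed
qed

section \<open>Generating functions\<close>

lemma complex_dim_cube: "complex_dim (cube n) = n"
  unfolding complex_dim_def
proof (rule Max_eqI)
  have "face_dim (replicate n CStar) = n"
    by (induction n) auto
  then show "n \<in> face_dim ` cube n"
    by (metis (mono_tags) cube_def image_eqI length_replicate mem_Collect_eq)
next
  show "y \<le> n" if "y \<in> face_dim ` cube n" for y
    using that face_dim_le_length by (auto simp: cube_def)
qed simp

text \<open>One factor for each coordinate: \<open>C0\<close>, \<open>C1\<close> and \<open>CStar\<close> contribute \<open>1\<close>, \<open>r\<close> and \<open>t * r\<close>.\<close>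

lemma cube_generating_function:
  fixes t r :: "'a :: comm_semiring_1"
  shows "(\<Sum>h\<in>cube n. t ^ face_dim h * r ^ weight h) = (1 + r + t * r) ^ n"
proof (induction n)
  case 0
  then show ?case by (simp add: cube_0 weight_def)
next
  case (Suc n)
  have "weight (a # h) = (if a = C0 then 0 else 1) + weight h" for a h
    by (simp add: weight_def)
  then have "(\<Sum>h\<in>cube (Suc n). t ^ face_dim h * r ^ weight h) =
      (1 + r + t * r) * (\<Sum>h\<in>cube n. t ^ face_dim h * r ^ weight h)"
    by (simp add: sum_cube_Suc algebra_simps sum_distrib_left sum.distrib)
  then show ?case
    by (simp add: Suc.IH)
qed

lemma spec_poly_Tot_cube: "spec_poly Tot n (cube n) = (1 + r_var ^ 2 + t_var * r_var ^ 2) ^ n"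
proof -
  have "(\<Sum>\<mu>\<in>#spec Tot n (cube n) k. monomial_tr k \<mu>) =
      (\<Sum>h\<in>{h \<in> cube n. face_dim h = k}. t_var ^ face_dim h * (r_var ^ 2) ^ weight h)" for k
  proof -
    have "(\<Sum>\<mu>\<in>#spec Tot n (cube n) k. monomial_tr k \<mu>) =
        (\<Sum>h\<in>set (face_list n (cube n) k). t_var ^ k * (r_var ^ 2) ^ weight h)"
      by (simp add: spec_Tot_cube image_mset.compositionality comp_def monomial_tr_eq
          sum_mset_sum_list sum_list_distinct_conv_sum_set distinct_face_list
          del: of_nat_mult flip: power_mult mset_map)
    then show ?thesis
      by (auto simp: set_face_list intro!: sum.cong)
  qed
  then have "spec_poly Tot n (cube n) =
      (\<Sum>k = 0..n. \<Sum>h\<in>{h \<in> cube n. face_dim h = k}. t_var ^ face_dim h * (r_var ^ 2) ^ weight h)"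
    unfolding spec_poly_def complex_dim_cube by (intro sum.cong refl)
  also have "\<dots> = (\<Sum>h\<in>cube n. t_var ^ face_dim h * (r_var ^ 2) ^ weight h)"
    using face_dim_le_length by (intro sum.group) (auto simp: cube_def finite_cube[unfolded cube_def])
  finally show ?thesis
    by (simp add: cube_generating_function)
qed

lemma lookup_sum_monomials:
  "Poly_Mapping.lookup (\<Sum>\<mu>\<in>#M. monomial_tr k \<mu>) (i, \<nu>) = (if k = i then int (count M \<nu>) else 0)"
  by (induction M) (auto simp: lookup_add monomial_tr_def lookup_single)

lemma of_nat_times_monomial: "of_nat c * monomial_tr i \<mu> = Poly_Mapping.single (i, \<mu>) (int c)"
  by (simp add: monomial_tr_def mult_single zero_prod_def flip: single_of_nat)

lemma spec_poly_UD_cube: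
  "eq_mod_r0 (spec_poly UD n (cube n))
      (\<Sum>k = 0..n - 1. t_var ^ k *
        (\<Sum>j = k + 1..n. of_nat (n choose j) * of_nat ((j - 1) choose k) * r_var ^ (2 * j)))"
    (is "eq_mod_r0 _ ?R")
  unfolding eq_mod_r0_def
proof (intro allI impI)
  fix i and \<mu> :: complex assume "\<mu> \<noteq> 0"
  let ?c = "\<lambda>k j. (n choose j) * ((j - 1) choose k)"
  have L: "Poly_Mapping.lookup (spec_poly UD n (cube n)) (i, \<mu>) =
      (if i \<le> n then int (count (spec UD n (cube n) i) \<mu>) else 0)"
    by (simp add: spec_poly_def complex_dim_cube lookup_sum lookup_sum_monomials)
  have monomial: "Poly_Mapping.single (k, of_nat (2 * j)) (int c) = of_nat c * (t_var ^ k * r_var ^ (2 * j))" for k j c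
    by (simp only: of_nat_times_monomial[symmetric] monomial_tr_eq)
  have "?R = (\<Sum>k = 0..n - 1. \<Sum>j = k + 1..n. Poly_Mapping.single (k, of_nat (2 * j)) (int (?c k j)))"
    unfolding monomial by (simp add: sum_distrib_left algebra_simps)
  then have "Poly_Mapping.lookup ?R (i, \<mu>) =
      (\<Sum>k = 0..n - 1. \<Sum>j = k + 1..n. if k = i \<and> of_nat (2 * j) = \<mu> then int (?c k j) else 0)"
    by (simp only: lookup_sum lookup_single when_def prod.inject)
  also have "\<dots> = (\<Sum>k = 0..n - 1. if k = i then (\<Sum>j = k + 1..n. if of_nat (2 * j) = \<mu> then int (?c k j) else 0) else 0)"
    by (intro sum.cong) auto
  also have "\<dots> = (if i \<le> n - 1 then (\<Sum>j = i + 1..n. if of_nat (2 * j) = \<mu> then int (?c i j) else 0) else 0)"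
    by simp
  finally have R: "Poly_Mapping.lookup ?R (i, \<mu>) = \<dots>" .
  show "Poly_Mapping.lookup (spec_poly UD n (cube n)) (i, \<mu>) = Poly_Mapping.lookup ?R (i, \<mu>)"
  proof (cases "\<exists>j. \<mu> = of_nat (2 * j)")
    case True
    then obtain j where j: "\<mu> = of_nat (2 * j)" by blast
    with \<open>\<mu> \<noteq> 0\<close> have "j \<ge> 1" by (cases j) auto
    have "(of_nat (2 * j') = \<mu>) = (j' = j)" for j'
      unfolding j of_nat_eq_iff by simp
    then have "Poly_Mapping.lookup ?R (i, \<mu>) = (if i \<le> n - 1 \<and> i + 1 \<le> j \<and> j \<le> n then int (?c i j) else 0)"
      unfolding R by auto
    \<comment> \<open>Outside the summation ranges, the case \<open>i = n\<close> included, the binomial coefficients vanish.\<close>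
    also have "\<dots> = (if i \<le> n then int (?c i j) else 0)"
      using \<open>j \<ge> 1\<close> by (auto simp: binomial_eq_0_iff)
    finally show ?thesis
      unfolding L using count_spec_UD_cube_even[OF \<open>j \<ge> 1\<close>, of n i] by (simp only: j)
  next
    case False
    then have "count (spec UD n (cube n) i) \<mu> = 0"
      using spec_cube_even[of \<mu> UD n i] by (auto simp: count_eq_zero_iff)
    then show ?thesis
      unfolding L R using False by (auto intro!: sum.neutral)
  qed
qed

theorem theorem3p4:
  fixes n :: nat
  assumes "n \<ge> 1"
  shows "laplacian_integral n (cube n) \<and>
    (\<forall>k. laplacian_integral n (skeleton k n)) \<and>
    spec_poly Tot n (cube n) = (1 + r_var ^ 2 + t_var * r_var ^ 2) ^ n \<and>
    (1 + r_var ^ 2 + t_var * r_var ^ 2) ^ n =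
      (\<Sum>k = 0..n. t_var ^ k * of_nat (n choose k) * r_var ^ (2 * k) * (1 + r_var ^ 2) ^ (n - k)) \<and>
    eq_mod_r0 (spec_poly UD n (cube n))
      (\<Sum>k = 0..n - 1. t_var ^ k *
        (\<Sum>j = k + 1..n. of_nat (n choose j) * of_nat ((j - 1) choose k) * r_var ^ (2 * j)))"
proof -
  have "(1 + r_var ^ 2 + t_var * r_var ^ 2) ^ n = (t_var * r_var ^ 2 + (1 + r_var ^ 2)) ^ n"
    by (simp add: add.commute)
  also have "\<dots> = (\<Sum>k = 0..n. t_var ^ k * of_nat (n choose k) * r_var ^ (2 * k) * (1 + r_var ^ 2) ^ (n - k))"
    unfolding binomial_ring[of "t_var * r_var ^ 2"]
    by (simp add: power_mult_distrib ac_simps flip: atMost_atLeast0 power_mult)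
  finally show ?thesis
    using laplacian_integral_cube laplacian_integral_skeleton spec_poly_Tot_cube spec_poly_UD_cube
    by blast
qed

end
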